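(* Let $p$ be a prime and $q=p^s$ for $s$ a positive integer. If $f(x)=a_px^p-a_1x-a_0\in \mathbb{F}_q[x]$ with $a_p a_1\neq 0$, then $f^2(x)$ is reducible over $\mathbb{F}_q$ if $p\geq 3$, and $f^3(x)$ is reducible over $\mathbb{F}_q$ if $p=2$.
   Context: $\mathbb{F}_q$ is the finite field with $q$ elements. For a polynomial $f$, $f^n$ denotes the $n$-fold composition of $f$ with itself (so $f^2=f\circ f$ and $f^3=f\circ f\circ f$). *)

theory Defs
  imports "HOL-Computational_Algebra.Computational_Algebra" "HOL-Library.Cardinality"
begin

definition poly_iter :: "'a::comm_semiring_1 poly \<Rightarrow> nat \<Rightarrow> 'a poly" where
  "poly_iter f n = ((\<lambda>g. pcompose f g) ^^ n) [:0, 1:]"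

text \<open>Zero and the units are neither irreducible nor reducible.\<close>

definition reducible :: "'a::comm_semiring_1 \<Rightarrow> bool" where
  "reducible x \<longleftrightarrow> x \<noteq> 0 \<and> \<not> x dvd 1 \<and> \<not> irreducible x"

lemma poly_iter_2: "poly_iter f 2 = pcompose f f"
  by (simp add: poly_iter_def numeral_2_eq_2 pcompose_idR)

lemma poly_iter_3: "poly_iter f 3 = pcompose f (pcompose f f)"
  by (simp add: poly_iter_def numeral_3_eq_3 pcompose_idR)

lemma reducible_field_poly_iff:
  fixes f :: "'a::field poly"
  shows "reducible f \<longleftrightarrow> (\<exists>g h. f = g * h \<and> degree g > 0 \<and> degree h > 0)"
proof
  assume "reducible f"
  then obtain g h where "f \<noteq> 0" "f = g * h" "\<not> g dvd 1" "\<not> h dvd 1"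
    by (auto simp: reducible_def irreducible_def)
  then show "\<exists>g h. f = g * h \<and> degree g > 0 \<and> degree h > 0"
    by (intro exI[of _ g] exI[of _ h]) (auto simp: is_unit_iff_degree)
next
  assume "\<exists>g h. f = g * h \<and> degree g > 0 \<and> degree h > 0"
  then obtain g h where gh: "f = g * h" "degree g > 0" "degree h > 0" by blast
  then have nz: "g \<noteq> 0" "h \<noteq> 0" by auto
  then have "\<not> g dvd 1" "\<not> h dvd 1" using gh by (auto simp: is_unit_iff_degree)
  moreover from this have "\<not> f dvd 1" using gh(1) dvd_mult_left by blast
  ultimately show "reducible f"
    using gh nz by (auto simp: reducible_def irreducible_def)
qed

end

theory Submission
  imports "HOL-Algebra.Algebraic_Closure_Type" Defs
begin

text \<open>
  An element \<open>x\<close> of the algebraic closure with \<open>x ^ q ^ N = x\<close> has degree at most \<open>N\<close> over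
  \<open>F\<^sub>q\<close>, so it suffices to find a root of \<open>f\<^sup>n\<close> satisfying this for some \<open>N < p ^ n\<close>. If the additive
  polynomial \<open>a\<^sub>p X ^ p - a\<^sub>1 X\<close> has no nonzero root in \<open>F\<^sub>q\<close>, then \<open>f\<close> permutes \<open>F\<^sub>q\<close> and its
  iterates have a root there (\<open>N = 1\<close>). Otherwise let \<open>d\<close> be such a root and put \<open>b = a\<^sub>1\<close> and
  \<open>e = a\<^sub>0 / (a\<^sub>1 d)\<close>. Dividing a root of \<open>f\<^sup>n\<close> and its images by \<open>d\<close> yields a tower of
  Artin--Schreier equations \<open>v ^ p = v + e\<close>, \<open>y ^ p = y + (e + v / b)\<close>,
  \<open>z ^ p = z + (e + y / b)\<close>. Since \<open>v ^ q ^ j = v + j t\<close> with \<open>t \<in> F\<^sub>p\<close>, the trace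
  \<open>\<Sum>j<p. (e + v / b) ^ q ^ j\<close> vanishes for odd \<open>p\<close>, so \<open>N = p\<close> works for \<open>f\<^sup>2\<close>. For
  \<open>p = 2\<close> it is only at the third level that the trace vanishes, giving \<open>N = 4\<close>.
\<close>

section \<open>Characteristic and Frobenius fixed points of a finite field\<close>

text \<open>Translation by 1 permutes the ring, so it leaves the sum of all elements
  unchanged.\<close>

lemma of_nat_CARD_eq_0: "of_nat CARD('a::{comm_ring_1, finite}) = (0::'a)"
proof -
  have "(\<Sum>x\<in>(UNIV::'a set). x + 1) = (\<Sum>x\<in>UNIV. x)"
    by (rule sum.reindex_bij_witness[of _ "\<lambda>x. x - 1" "\<lambda>x. x + 1"]) auto
  thus ?thesis by (simp add: sum.distrib)
qed

lemma CHAR_eqI: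
  fixes p s :: nat
  assumes "prime p" "CARD('a::{field, finite}) = p ^ s"
  shows "CHAR('a) = p"
proof -
  have dvd: "CHAR('a) dvd p ^ s"
    using of_nat_CARD_eq_0[where 'a='a] by (simp only: of_nat_eq_0_iff_char_dvd assms(2))
  with assms(1) have "CHAR('a) > 0" by (metis dvd_0_left_iff gr0I not_prime_0 power_not_zero)
  hence "prime CHAR('a)" by (rule prime_CHAR_semidom)
  with dvd assms(1) show ?thesis
    by (metis prime_dvd_power primes_dvd_imp_eq)
qed

text \<open>Multiplication by a nonzero \<open>x\<close> permutes the units; cancelling their
  product gives \<open>x ^ (CARD('a) - 1) = 1\<close>.\<close>

lemma power_CARD_eq_same:
  fixes x :: "'a::{field, finite}"
  shows "x ^ CARD('a) = x"
proof (cases "x = 0")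
  case False
  have pos: "CARD('a) > 0" by simp
  have "(\<Prod>y\<in>UNIV-{0}. x * y) = (\<Prod>y\<in>UNIV-{0}. y)"
    by (rule prod.reindex_bij_witness[of _ "\<lambda>y. y / x" "\<lambda>y. x * y"]) (use False in auto)
  hence "x ^ (CARD('a) - 1) = 1"
    by (simp add: prod.distrib)
  thus ?thesis
    using pos by (metis Suc_diff_1 mult.right_neutral power_Suc)
qed auto

section \<open>Evaluation at points of the algebraic closure\<close>

definition eval_ac :: "'a::field poly \<Rightarrow> 'a alg_closure \<Rightarrow> 'a alg_closure" where
  "eval_ac p x = poly (map_poly to_ac p) x"

lemma eval_ac_0 [simp]: "eval_ac 0 x = 0"
  and eval_ac_pCons [simp]: "eval_ac (pCons a p) x = to_ac a + x * eval_ac p x"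
  by (simp_all add: eval_ac_def map_poly_pCons)

lemma eval_ac_add [simp]: "eval_ac (p + q) x = eval_ac p x + eval_ac q x"
proof -
  have "map_poly to_ac (p + q) = map_poly to_ac p + map_poly to_ac q"
    by (intro poly_eqI) (simp add: coeff_map_poly)
  thus ?thesis by (simp add: eval_ac_def)
qed

lemma eval_ac_smult [simp]: "eval_ac (smult c p) x = to_ac c * eval_ac p x"
  by (simp add: eval_ac_def map_poly_smult)

lemma eval_ac_diff [simp]: "eval_ac (p - q) x = eval_ac p x - eval_ac q x"
  using eval_ac_add[of "p - q" q x] by (simp add: algebra_simps del: eval_ac_add)

lemma eval_ac_mult [simp]: "eval_ac (p * q) x = eval_ac p x * eval_ac q x"
  by (induction p) (simp_all add: algebra_simps)

lemma eval_ac_sum: "eval_ac (\<Sum>i\<in>A. f i) x = (\<Sum>i\<in>A. eval_ac (f i) x)"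
  by (induction A rule: infinite_finite_induct) simp_all

lemma eval_ac_monom [simp]: "eval_ac (monom c n) x = to_ac c * x ^ n"
  by (simp add: eval_ac_def map_poly_monom poly_monom)

lemma eval_ac_pcompose [simp]: "eval_ac (pcompose p q) x = eval_ac p (eval_ac q x)"
  by (induction p) (simp_all add: pcompose_pCons)

lemma eval_ac_to_ac: "eval_ac p (to_ac c) = to_ac (poly p c)"
  by (induction p) simp_all

lemma eval_ac_has_root:
  assumes "degree p > 0"
  obtains x where "eval_ac p x = 0"
proof -
  have "degree (map_poly to_ac p) > 0" using assms by (subst degree_map_poly) auto
  from alg_closed_imp_poly_has_root[OF this] show thesis
    using that by (auto simp: eval_ac_def)
qed

section \<open>Degree bounds for irreducible polynomials\<close>

text \<open>A nonzero polynomial \<open>m\<close> of least degree vanishing at \<open>x\<close>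
  divides \<open>p\<close> and is not a unit, so it is associated to the irreducible
  \<open>p\<close>.\<close>

lemma irreducible_degree_le:
  assumes "irreducible p" "eval_ac p x = 0" "u \<noteq> 0" "eval_ac u x = 0"
  shows "degree p \<le> degree u"
proof -
  define P where "P m \<longleftrightarrow> m \<noteq> 0 \<and> eval_ac m x = 0" for m
  define m where "m = arg_min degree P"
  have "P u" using assms by (simp add: P_def)
  hence m: "P m" and min: "\<And>v. P v \<Longrightarrow> degree m \<le> degree v"
    unfolding m_def by (auto intro: arg_min_natI arg_min_nat_le)
  have "eval_ac p x = eval_ac m x * eval_ac (p div m) x + eval_ac (p mod m) x"
    by (simp flip: eval_ac_mult eval_ac_add)
  hence "eval_ac (p mod m) x = 0" using m assms(2) by (simp add: P_def)
  hence "p mod m = 0"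
    using min[of "p mod m"] m degree_mod_less[of m p] by (fastforce simp: P_def not_less[symmetric])
  then obtain k where k: "p = m * k" by auto
  have "\<not> m dvd 1"
  proof
    assume "m dvd 1"
    then obtain c where "m * c = 1" by (metis dvd_def)
    hence "eval_ac m x * eval_ac c x = eval_ac [:1:] x" by (simp flip: eval_ac_mult add: one_pCons)
    with m show False by (simp add: P_def)
  qed
  with k assms(1) have "k dvd 1" by (metis irreducibleD)
  hence "degree k = 0" by (metis dvd_0_left_iff is_unit_iff_degree one_neq_zero)
  hence "degree p \<le> degree m" using k by (metis add.right_neutral degree_mult_le)
  also have "\<dots> \<le> degree u" using min \<open>P u\<close> by blast
  finally show ?thesis .
qed

lemma power_fixed_iterate:
  fixes x :: "'a::monoid_mult"
  assumes "x ^ m = x"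
  shows "x ^ (m ^ n) = x"
  using assms by (induction n) (simp_all add: power_mult)

text \<open>By pigeonhole: there are more polynomials of degree at most \<open>n\<close> than
  roots of \<open>X ^ q ^ n - X\<close>.\<close>

lemma annihilating_poly_of_power_fixed:
  fixes x :: "'a::{field, finite} alg_closure"
  assumes char: "prime CHAR('a)" "CARD('a) = CHAR('a) ^ s"
    and x: "x ^ (CARD('a) ^ n) = x" and n: "n > 0"
  obtains u :: "'a poly" where "u \<noteq> 0" "degree u \<le> n" "eval_ac u x = 0"
proof -
  let ?q = "CARD('a)" and ?h = "\<lambda>f. \<Sum>i\<le>n. to_ac (f i :: 'a) * x ^ i"
  let ?D = "{..n} \<rightarrow>\<^sub>E (UNIV :: 'a set)"
  let ?X = "monom 1 (?q ^ n) - monom 1 1 :: 'a alg_closure poly"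
  define R where "R = {y. poly ?X y = 0}"
  have R: "y \<in> R \<longleftrightarrow> y ^ (?q ^ n) = y" for y by (simp add: R_def poly_monom)
  have "card {0, 1::'a} \<le> ?q" by (rule card_mono) auto
  hence q: "?q > 1" by simp
  with n have qn: "?q ^ n > 1" by (intro one_less_power)
  hence "coeff ?X (?q ^ n) = 1" by simp
  hence X0: "?X \<noteq> 0" by (metis coeff_0 zero_neq_one)
  have "degree ?X \<le> ?q ^ n"
    by (rule degree_diff_le) (use qn in \<open>auto simp: degree_monom_eq\<close>)
  hence cR: "card R \<le> ?q ^ n"
    unfolding R_def using card_poly_roots_bound[OF X0] by linarith
  have fR: "finite R" unfolding R_def by (rule poly_roots_finite[OF X0])
  have m: "?q ^ n = CHAR('a alg_closure) ^ (s * n)" by (simp add: char(2) power_mult)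
  \<comment> \<open>Both the coefficients and \<open>x\<close> are fixed by the additive map
    \<open>y ^ (?q ^ n)\<close>, hence so is every value of \<open>?h\<close>.\<close>
  have "?h ` ?D \<subseteq> R"
  proof safe
    fix f :: "nat \<Rightarrow> 'a"
    have "?h f ^ (?q ^ n) = (\<Sum>i\<le>n. (to_ac (f i) * x ^ i) ^ (?q ^ n))"
      by (rule freshmans_dream_sum'[OF _ m]) (use char in simp)
    also have "\<dots> = ?h f"
    proof (rule sum.cong)
      fix i
      have "(to_ac (f i) * x ^ i) ^ (?q ^ n) = to_ac (f i ^ (?q ^ n)) * (x ^ (?q ^ n)) ^ i"
        by (simp add: power_mult_distrib mult.commute flip: power_mult)
      also have "\<dots> = to_ac (f i) * x ^ i"
        by (simp only: power_fixed_iterate[OF power_CARD_eq_same] x)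
      finally show "(to_ac (f i) * x ^ i) ^ (?q ^ n) = to_ac (f i) * x ^ i" .
    qed auto
    finally show "?h f \<in> R" by (simp add: R)
  qed
  moreover have "card ?D > card R"
  proof -
    have "card ?D = ?q ^ Suc n" by (simp add: card_PiE)
    moreover have "?q ^ n < ?q ^ Suc n" using q by (intro power_strict_increasing) auto
    ultimately show ?thesis using cR by linarith
  qed
  ultimately have "\<not> inj_on ?h ?D"
    using card_inj_on_le[of ?h ?D R] fR by auto
  then obtain f g where fg: "f \<in> ?D" "g \<in> ?D" "f \<noteq> g" "?h f = ?h g"
    by (auto simp: inj_on_def)
  define u where "u = (\<Sum>i\<le>n. monom (f i - g i) i)"
  have cu: "coeff u i = (if i \<le> n then f i - g i else 0)" for i
    by (simp add: u_def coeff_sum)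
  obtain i where i: "f i \<noteq> g i" using fg(3) by auto
  hence "i \<le> n" using fg(1,2) by (metis PiE_arb atMost_iff)
  with i have "coeff u i \<noteq> 0" by (simp add: cu)
  hence "u \<noteq> 0" by auto
  moreover have "degree u \<le> n" by (rule degree_le) (simp add: cu)
  moreover have "eval_ac u x = 0"
    using fg(4) by (simp add: u_def eval_ac_sum algebra_simps sum_subtractf)
  ultimately show thesis by (rule that)
qed

lemma irreducible_degree_le_of_power_fixed:
  fixes P :: "'a::{field, finite} poly"
  assumes "prime CHAR('a)" "CARD('a) = CHAR('a) ^ s"
    and "irreducible P" "eval_ac P x = 0" "x ^ (CARD('a) ^ n) = x" "n > 0"
  shows "degree P \<le> n"
proof -
  obtain u :: "'a poly" where "u \<noteq> 0" "degree u \<le> n" "eval_ac u x = 0"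
    by (rule annihilating_poly_of_power_fixed[OF assms(1,2,5,6)])
  thus ?thesis using irreducible_degree_le[OF assms(3,4)] le_trans by blast
qed

section \<open>Artin--Schreier equations\<close>

text \<open>Raising to the power \<open>m\<close> is additive, so each further application
  contributes one more conjugate of \<open>w\<close>.\<close>

lemma additive_power_iterate:
  fixes z w :: "'a::comm_semiring_1"
  assumes "prime CHAR('a)" "m = CHAR('a) ^ k" "z ^ m = z + w"
  shows "z ^ (m ^ n) = z + (\<Sum>i<n. w ^ (m ^ i))"
proof (induction n)
  case (Suc n)
  have m: "m ^ n = CHAR('a) ^ (k * n)" by (simp add: assms(2) power_mult)
  have "z ^ (m ^ Suc n) = (z + w) ^ (m ^ n)"
    by (simp add: power_mult assms(3))
  also have "\<dots> = z ^ (m ^ n) + w ^ (m ^ n)"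
    by (rule freshmans_dream'[OF assms(1) m])
  finally show ?case using Suc by (simp add: add.assoc)
qed auto

text \<open>Swapping the two sums puts the sum of the first \<open>n\<close> \<open>q\<close>-power
  conjugates of \<open>w\<close> inside: as soon as it vanishes, \<open>z\<close> is fixed by the
  power \<open>q ^ n\<close>.\<close>

lemma artin_schreier_iterate:
  fixes z w :: "'a::comm_semiring_1"
  assumes "prime CHAR('a)" "q = CHAR('a) ^ s" "z ^ CHAR('a) = z + w"
  shows "z ^ (q ^ n) = z + (\<Sum>i<s. (\<Sum>j<n. w ^ (q ^ j)) ^ (CHAR('a) ^ i))"
proof -
  let ?p = "CHAR('a)"
  have "z ^ (?p ^ s) = z + (\<Sum>i<s. w ^ (?p ^ i))"
    using additive_power_iterate[of "?p" 1 z w s] assms by simp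
  hence "z ^ q = z + (\<Sum>i<s. w ^ (?p ^ i))" by (simp add: assms(2))
  hence "z ^ (q ^ n) = z + (\<Sum>j<n. (\<Sum>i<s. w ^ (?p ^ i)) ^ (q ^ j))"
    by (rule additive_power_iterate[OF assms(1,2)])
  also have "(\<Sum>j<n. (\<Sum>i<s. w ^ (?p ^ i)) ^ (q ^ j)) = (\<Sum>j<n. \<Sum>i<s. (w ^ (q ^ j)) ^ (?p ^ i))"
  proof (rule sum.cong)
    fix j
    have "q ^ j = ?p ^ (s * j)" by (simp add: assms(2) power_mult)
    hence "(\<Sum>i<s. w ^ (?p ^ i)) ^ (q ^ j) = (\<Sum>i<s. (w ^ (?p ^ i)) ^ (q ^ j))"
      by (rule freshmans_dream_sum'[OF assms(1)])
    thus "(\<Sum>i<s. w ^ (?p ^ i)) ^ (q ^ j) = (\<Sum>i<s. (w ^ (q ^ j)) ^ (?p ^ i))"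
      by (simp add: mult.commute flip: power_mult)
  qed auto
  also have "\<dots> = (\<Sum>i<s. \<Sum>j<n. (w ^ (q ^ j)) ^ (?p ^ i))" by (rule sum.swap)
  also have "\<dots> = (\<Sum>i<s. (\<Sum>j<n. w ^ (q ^ j)) ^ (?p ^ i))"
    by (intro sum.cong refl freshmans_dream_sum'[OF assms(1), symmetric]) auto
  finally show ?thesis .
qed

lemma additive_power_trace_fixed:
  fixes w :: "'a::comm_semiring_1"
  assumes "prime CHAR('a)" "q = CHAR('a) ^ s" "w ^ q = w"
  shows "(\<Sum>i<k. w ^ (CHAR('a) ^ i)) ^ q = (\<Sum>i<k. w ^ (CHAR('a) ^ i))"
proof -
  have "(\<Sum>i<k. w ^ (CHAR('a) ^ i)) ^ q = (\<Sum>i<k. (w ^ (CHAR('a) ^ i)) ^ q)"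
    by (rule freshmans_dream_sum'[OF assms(1,2)])
  also have "\<dots> = (\<Sum>i<k. (w ^ q) ^ (CHAR('a) ^ i))"
    by (simp add: mult.commute flip: power_mult)
  finally show ?thesis by (simp add: assms(3))
qed

lemma artin_schreier_over_base:
  fixes e v :: "'a::comm_semiring_1"
  assumes "prime CHAR('a)" "q = CHAR('a) ^ s" "e ^ q = e" "v ^ CHAR('a) = v + e"
  obtains t where "t ^ q = t" "\<And>j. v ^ (q ^ j) = v + of_nat j * t"
proof -
  \<comment> \<open>The absolute trace of \<open>e\<close>. As it is fixed by the
    \<open>q\<close>-power map, each application of that map adds the same \<open>t\<close> to
    \<open>v\<close>.\<close>
  define t where "t = (\<Sum>i<s. e ^ (CHAR('a) ^ i))"
  have t: "t ^ q = t"
    unfolding t_def by (rule additive_power_trace_fixed[OF assms(1-3)])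
  have "v ^ q = v + t"
    using artin_schreier_iterate[OF assms(1,2,4), of 1] by (simp add: t_def)
  from additive_power_iterate[OF assms(1,2) this]
  have "v ^ (q ^ j) = v + of_nat j * t" for j
    by (simp add: power_fixed_iterate[OF t])
  with t show thesis by (rule that)
qed

text \<open>The \<open>p\<close> conjugates of \<open>e + v / b\<close> form an arithmetic
  progression with difference \<open>t / b\<close>; for odd \<open>p\<close> both \<open>p\<close>
  and 0 + 1 + ... + (p - 1) vanish in characteristic \<open>p\<close>, so their sum is 0.\<close>

lemma artin_schreier_tower_odd:
  fixes b e v y :: "'a::field"
  assumes p: "prime CHAR('a)" "CHAR('a) \<ge> 3" and q: "q = CHAR('a) ^ s"
    and base: "b ^ q = b" "e ^ q = e"
    and v: "v ^ CHAR('a) = v + e" and y: "y ^ CHAR('a) = y + (e + v / b)"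
  shows "y ^ (q ^ CHAR('a)) = y"
proof -
  let ?p = "CHAR('a)"
  obtain t where t: "\<And>j. v ^ (q ^ j) = v + of_nat j * t"
    using artin_schreier_over_base[OF p(1) q base(2) v] by metis
  have w: "(e + v / b) ^ (q ^ j) = e + v / b + of_nat j * (t / b)" for j
  proof -
    have "q ^ j = ?p ^ (s * j)" by (simp add: q power_mult)
    from freshmans_dream'[OF p(1) this]
    have "(e + v / b) ^ (q ^ j) = e ^ (q ^ j) + (v / b) ^ (q ^ j)" .
    thus ?thesis
      by (simp add: power_divide t power_fixed_iterate base add_divide_distrib)
  qed
  have "odd ?p" using p prime_odd_nat[of ?p] by linarith
  moreover have "2 * \<Sum>{..<n} = n * (n - 1)" for n :: nat
  proof (induction n)
    case (Suc n)
    thus ?case by (cases n) simp_all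
  qed simp
  hence "?p dvd 2 * \<Sum>{..<?p}" by simp
  ultimately have "?p dvd \<Sum>{..<?p}"
    by (metis coprime_dvd_mult_right_iff coprime_right_2_iff_odd)
  hence "of_nat (\<Sum>{..<?p}) = (0::'a)" by (simp add: of_nat_eq_0_iff_char_dvd del: of_nat_sum)
  hence "(\<Sum>j<?p. of_nat j :: 'a) = 0" by simp
  hence "(\<Sum>j<?p. (e + v / b) ^ (q ^ j)) = 0"
    by (simp add: w sum.distrib of_nat_CHAR flip: sum_distrib_right sum_divide_distrib)
  \<comment> \<open>Makes the exponents \<open>?p ^ i\<close> nonzero, so that
    \<open>0 ^ (?p ^ i)\<close> is 0 and not 1.\<close>
  moreover have "?p \<noteq> 0" using p by simp
  ultimately show ?thesis
    using artin_schreier_iterate[OF p(1) q y, of ?p] by (simp add: power_0_left)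
qed

lemma artin_schreier_tower_even:
  fixes b e v y z :: "'a::field"
  assumes p: "CHAR('a) = 2" and q: "q = 2 ^ s"
    and base: "b ^ q = b" "e ^ q = e"
    and v: "v\<^sup>2 = v + e" and y: "y\<^sup>2 = y + (e + v / b)" and z: "z\<^sup>2 = z + (e + y / b)"
  shows "z ^ (q ^ 4) = z"
proof -
  have p': "prime CHAR('a)" and q': "q = CHAR('a) ^ s"
    by (simp_all add: p q two_is_prime_nat)
  have two: "(2::'a) = 0" using of_nat_CHAR[where 'a='a] by (simp add: p)
  have dbl: "x + x = 0" for x :: 'a using two by (metis mult_2 mult_zero_left)
  have fd: "(x + x') ^ (q ^ j) = x ^ (q ^ j) + x' ^ (q ^ j)" for x x' :: 'a and j
    by (rule freshmans_dream'[OF p', of _ "s * j"]) (simp add: q' power_mult)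
  note fd1 = fd[of _ _ 1, simplified]
  obtain t where t: "t ^ q = t" "\<And>j. v ^ (q ^ j) = v + of_nat j * t"
    using artin_schreier_over_base[OF p' q' base(2)] v p by metis
  \<comment> \<open>The increment of \<open>y\<close> under the power \<open>q ^ 2\<close>: the two
    conjugates of \<open>e + v / b\<close> only sum to \<open>t / b\<close>.\<close>
  define r where "r = (\<Sum>i<s. (t / b) ^ (CHAR('a) ^ i))"
  have r: "r ^ q = r"
    unfolding r_def by (rule additive_power_trace_fixed[OF p' q']) (simp add: power_divide t base)
  have vq: "v ^ q = v + t" using t(2)[of 1] by simp
  have "(\<Sum>j<2. (e + v / b) ^ (q ^ j)) = (e + e) + (v / b + v / b) + t / b"
    by (simp add: numeral_2_eq_2 fd1 power_divide vq base add_divide_distrib)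
  also have "\<dots> = t / b" by (simp only: dbl add_0_left)
  finally have y2: "y ^ (q ^ 2) = y + r"
    using artin_schreier_iterate[OF p' q', of y "e + v / b" 2] y p by (simp add: r_def)
  have y3: "y ^ (q ^ 3) = y ^ q + r"
  proof -
    have "q ^ 3 = q ^ 2 * q" by (simp add: power2_eq_square power3_eq_cube)
    hence "y ^ (q ^ 3) = (y ^ (q ^ 2)) ^ q" by (simp only: power_mult)
    thus ?thesis by (simp add: y2 fd1 r)
  qed
  have sum4: "(\<Sum>j<4. g j) = g 0 + g 1 + g 2 + g 3" for g :: "nat \<Rightarrow> 'a"
    by (simp add: eval_nat_numeral)
  have "(\<Sum>j<4. (e + y / b) ^ (q ^ j)) = (\<Sum>j<4. e + y ^ (q ^ j) / b)"
    by (simp add: fd power_divide power_fixed_iterate base)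
  \<comment> \<open>The four conjugates of \<open>y\<close> are \<open>y\<close>,
    \<open>y ^ q\<close>, \<open>y + r\<close> and \<open>y ^ q + r\<close>, so every term occurs an
    even number of times.\<close>
  also have "\<dots> = ((e + e) + (e + e)) + ((y + y) + (y ^ q + y ^ q) + (r + r)) / b"
    by (simp add: sum4 y2 y3 add_divide_distrib algebra_simps)
  also have "\<dots> = 0" by (simp only: dbl add_0_left div_0)
  finally show ?thesis
    using artin_schreier_iterate[OF p' q', of z "e + y / b" 4] z p by (simp add: power_0_left)
qed

section \<open>Reducibility of the iterates\<close>

theorem theorem29:
  fixes p q s :: nat
    and a\<^sub>p a\<^sub>1 a\<^sub>0 :: "'a::{field, finite}"
    and f :: "'a poly"
  assumes "prime p" and "s > 0" and "q = p ^ s" and "CARD('a) = q"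
    and "f = monom a\<^sub>p p - monom a\<^sub>1 1 - monom a\<^sub>0 0"
    and "a\<^sub>p * a\<^sub>1 \<noteq> 0"
  shows "(p \<ge> 3 \<longrightarrow> reducible (poly_iter f 2)) \<and> (p = 2 \<longrightarrow> reducible (poly_iter f 3))"
proof -
  let ?q = "CARD('a)"
  note p = assms(1)
  have a1: "a\<^sub>1 \<noteq> 0" and ap: "a\<^sub>p \<noteq> 0" using assms(6) by auto
  have card: "?q = p ^ s" by (simp add: assms)
  have char: "CHAR('a) = p" by (rule CHAR_eqI[OF p card])
  have p1: "p > 1" using p by (rule prime_gt_1_nat)
  have deg: "degree f = p"
  proof (rule antisym)
    show "degree f \<le> p"
      unfolding assms(5) using p1 by (intro degree_diff_le) (auto intro: order.trans[OF degree_monom_le])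
    show "p \<le> degree f"
      using ap p1 by (intro le_degree) (simp add: assms(5))
  qed
  have deg2: "degree (poly_iter f 2) = p ^ 2" and deg3: "degree (poly_iter f 3) = p ^ 3"
    by (simp_all add: poly_iter_2 poly_iter_3 degree_pcompose deg power2_eq_square power3_eq_cube)
  have red: "reducible P"
    if "N < degree P" "N > 0" "eval_ac P x = 0" "x ^ (?q ^ N) = x" for P :: "'a poly" and x N
  proof -
    have "\<not> irreducible P"
      using irreducible_degree_le_of_power_fixed[of s P x N] that card char p by auto
    moreover have "P \<noteq> 0" using that(1) by auto
    ultimately show ?thesis
      using that(1) by (auto simp: reducible_def is_unit_iff_degree)
  qed
  show ?thesis
  proof (cases "\<exists>d. d \<noteq> 0 \<and> a\<^sub>p * d ^ p = a\<^sub>1 * d")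
    case False
    have "inj (poly f)"
    proof (rule injI)
      fix u v assume uv: "poly f u = poly f v"
      have "(v + (u - v)) ^ p = v ^ p + (u - v) ^ p"
        by (rule freshmans_dream) (use char p in simp_all)
      \<comment> \<open>The constant term cancels in \<open>poly f u - poly f v\<close>, which
        leaves the additive part of \<open>f\<close> at \<open>u - v\<close>.\<close>
      with uv have "a\<^sub>p * (u - v) ^ p = a\<^sub>1 * (u - v)"
        by (simp add: assms(5) poly_monom algebra_simps)
      with False have "u - v = 0" by blast
      thus "u = v" by simp
    qed
    hence surj: "surj (poly f)" by (simp add: finite_UNIV_inj_surj)
    obtain r0 where r0: "poly f r0 = 0" using surj by (metis surjD)
    obtain r1 where r1: "poly f r1 = r0" using surj by (metis surjD)
    obtain r2 where r2: "poly f r2 = r1" using surj by (metis surjD)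
    \<comment> \<open>Here the preimages of 0 lie in the base field, so the degree bound is
      1.\<close>
    have fixed: "to_ac r ^ (?q ^ 1) = to_ac r" for r :: 'a
      by (simp add: power_CARD_eq_same flip: to_ac_power)
    have large: "1 < p ^ 2" "1 < p ^ 3" by (intro one_less_power[OF p1]; simp)+
    have "reducible (poly_iter f 2)"
      by (rule red[of 1 _ "to_ac r1"])
         (use large in \<open>simp_all only: deg2 fixed eval_ac_to_ac\<close>, simp_all add: poly_iter_2 poly_pcompose r0 r1)
    moreover have "reducible (poly_iter f 3)"
      by (rule red[of 1 _ "to_ac r2"])
         (use large in \<open>simp_all only: deg3 fixed eval_ac_to_ac\<close>, simp_all add: poly_iter_3 poly_pcompose r0 r1 r2)
    ultimately show ?thesis by blast
  next
    case True
    then obtain d where d: "d \<noteq> 0" "a\<^sub>p * d ^ p = a\<^sub>1 * d" by blast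
    define D b e where "D = to_ac d" and "b = to_ac a\<^sub>1" and "e = to_ac (a\<^sub>0 / (a\<^sub>1 * d))"
    have D: "D \<noteq> 0" and b: "b \<noteq> 0" using d a1 by (simp_all add: D_def b_def)
    have base: "D ^ ?q = D" "b ^ ?q = b" "e ^ ?q = e"
      by (simp_all only: D_def b_def e_def power_CARD_eq_same flip: to_ac_power)
    \<comment> \<open>From \<open>a\<^sub>p = a\<^sub>1 * d / d ^ p\<close> one gets
      \<open>f(r) = a\<^sub>1 * d * ((r / d) ^ p - r / d - e)\<close>; this dictates the choice of
      \<open>e\<close>.\<close>
    have step: "(r / D) ^ p = r / D + (e + (eval_ac f r / D) / b)" for r
    proof -
      have "to_ac (a\<^sub>p * d ^ p) = to_ac (a\<^sub>1 * d)" using d by simp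
      hence D_eq: "to_ac a\<^sub>p = b * D / D ^ p" using D by (simp add: D_def b_def field_simps)
      have e_eq: "to_ac a\<^sub>0 = b * D * e" using d a1 by (simp add: D_def b_def e_def)
      show ?thesis
        using D b by (simp add: assms(5) D_eq e_eq power_divide field_simps flip: b_def)
    qed
    have unscale: "r ^ (?q ^ N) = r" if "(r / D) ^ (?q ^ N) = r / D" for r N
      using that D by (simp add: power_divide power_fixed_iterate base)
    show ?thesis
    proof (intro conjI impI)
      assume "p \<ge> 3"
      have "degree (poly_iter f 2) > 0" using p1 by (simp add: deg2)
      then obtain x where x: "eval_ac (poly_iter f 2) x = 0" by (rule eval_ac_has_root)
      define v y where "v = eval_ac f x / D" and "y = x / D"
      have "v ^ p = v + e"
        using step[of "eval_ac f x"] x by (simp add: v_def poly_iter_2)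
      moreover have "y ^ p = y + (e + v / b)" using step[of x] by (simp add: v_def y_def)
      ultimately have "y ^ (?q ^ p) = y"
        using artin_schreier_tower_odd[of ?q s b e v y] \<open>p \<ge> 3\<close> p char card base by simp
      hence "x ^ (?q ^ p) = x" unfolding y_def by (rule unscale)
      \<comment> \<open>The degree bound \<open>p\<close> stays below the degree
        \<open>p ^ 2\<close> of the second iterate.\<close>
      moreover have "p < p ^ 2" using p1 by (simp add: power2_eq_square)
      ultimately show "reducible (poly_iter f 2)"
        using red[of p _ x] x p1 deg2 by simp
    next
      assume p2: "p = 2"
      have "degree (poly_iter f 3) > 0" using p1 by (simp add: deg3)
      then obtain x where x: "eval_ac (poly_iter f 3) x = 0" by (rule eval_ac_has_root)
      define v y z where "v = eval_ac f (eval_ac f x) / D" and "y = eval_ac f x / D" and "z = x / D"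
      have "v\<^sup>2 = v + e"
        using step[of "eval_ac f (eval_ac f x)"] x by (simp add: v_def poly_iter_3 p2)
      moreover have "y\<^sup>2 = y + (e + v / b)" using step[of "eval_ac f x"] by (simp add: v_def y_def p2)
      moreover have "z\<^sup>2 = z + (e + y / b)" using step[of x] by (simp add: z_def y_def p2)
      ultimately have "z ^ (?q ^ 4) = z"
        using artin_schreier_tower_even[of ?q s b e v y z] char card base p2 by simp
      hence "x ^ (?q ^ 4) = x" unfolding z_def by (rule unscale)
      \<comment> \<open>The degree bound 4 is below the degree 8 of the third iterate, whereas it
        would equal that of the second.\<close>
      thus "reducible (poly_iter f 3)"
        using red[of 4 _ x] x deg3 p2 by simp
    qed
  qed
qed

end
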